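(* There are $n$-node undirected graphs $G$ such that any shortest-paths preserving graph $H$ of $G$ has aspect ratio $2^{\Omega(n)}$.
   Context: The aspect ratio of a graph with positive edge weights $w$ is $\max_e w(e)/\min_e w(e)$. Given a graph $G=(V,E,w)$, a reweighted graph $H=(V,E,w_H)$ on the same vertex and edge set with positive weights $w_H$ is called shortest-paths preserving if for every shortest path $\pi$ in $H$, the sequence of nodes and edges along $\pi$ is also a shortest path in $G$. The bound $2^{\Omega(n)}$ means: there is an absolute constant $c>0$ such that for infinitely many $n$ there is such a graph $G$ for which every shortest-paths preserving $H$ has aspect ratio at least $2^{cn}$. *)

theory Defs
  imports Complex_Main "HOL-Library.Infinite_Set"
begin

record 'a wgraph =
  verts :: "'a set"
  edges :: "'a set set"
  weight :: "'a set \<Rightarrow> real"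

text \<open>Finite simple undirected graphs with positive edge weights. An edge is the set of its two
  endpoints; the values of the weight function outside the edge set are irrelevant.\<close>

definition weighted_graph :: "'a wgraph \<Rightarrow> bool" where
  "weighted_graph G \<longleftrightarrow>
     finite (verts G) \<and>
     edges G \<subseteq> {{u, v} | u v. u \<in> verts G \<and> v \<in> verts G \<and> u \<noteq> v} \<and>
     (\<forall>e \<in> edges G. weight G e > 0)"

text \<open>As the graphs are simple, the sequence of nodes and edges along a path is determined by its
  list of nodes.\<close>

fun path_edges :: "'a list \<Rightarrow> 'a set list" where
  "path_edges (u # v # p) = {u, v} # path_edges (v # p)"
| "path_edges _ = []"

definition is_path :: "'a wgraph \<Rightarrow> 'a list \<Rightarrow> bool" where
  "is_path G p \<longleftrightarrow>
     p \<noteq> [] \<and> distinct p \<and> set p \<subseteq> verts G \<and> set (path_edges p) \<subseteq> edges G"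

definition path_weight :: "'a wgraph \<Rightarrow> 'a list \<Rightarrow> real" where
  "path_weight G p = sum_list (map (weight G) (path_edges p))"

definition shortest_path :: "'a wgraph \<Rightarrow> 'a list \<Rightarrow> bool" where
  "shortest_path G p \<longleftrightarrow>
     is_path G p \<and>
     (\<forall>q. is_path G q \<and> hd q = hd p \<and> last q = last p \<longrightarrow> path_weight G p \<le> path_weight G q)"

definition shortest_paths_preserving :: "'a wgraph \<Rightarrow> 'a wgraph \<Rightarrow> bool" where
  "shortest_paths_preserving G H \<longleftrightarrow>
     weighted_graph H \<and> verts H = verts G \<and> edges H = edges G \<and>
     (\<forall>p. shortest_path H p \<longrightarrow> shortest_path G p)"

text \<open>Only meaningful for graphs that have at least one edge.\<close>

definition aspect_ratio :: "'a wgraph \<Rightarrow> real" where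
  "aspect_ratio G = Max (weight G ` edges G) / Min (weight G ` edges G)"

end

theory Submission
  imports Defs
begin

text \<open>Take \<open>k\<close> levels, level \<open>i\<close> consisting of the light path \<open>3 i + 1, 3 i, 3 i + 2\<close>, and join
  consecutive levels by heavy edges from \<open>3 i + 1\<close> to \<open>3 i + 3\<close> and from \<open>3 i + 2\<close> to
  \<open>3 i + 4\<close> and \<open>3 i + 5\<close>. If the light weights grow fast enough, a shortest path between opposite
  corners of the cycle formed by the light path of level \<open>i\<close>, one light edge of level \<open>i + 1\<close> and
  the two heavy edges joining their ends uses the light path of level \<open>i\<close>, for either pair of corners.
  Shortest paths being unique here, the two inequalities persist in \<open>H\<close>; in their sum the heavy
  weights cancel, so each light edge of level \<open>i + 1\<close> weighs in \<open>H\<close> at least as much as both light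
  edges of level \<open>i\<close> together.\<close>

section \<open>Uniqueness of shortest paths by potentials\<close>

lemma path_weight_simps [simp]:
  "path_weight G [] = 0"
  "path_weight G [u] = 0"
  "path_weight G (u # v # p) = weight G {u, v} + path_weight G (v # p)"
  by (simp_all add: path_weight_def)

text \<open>The potential differences telescope along \<open>q\<close>, and each is bounded by its
  edge weight.\<close>

lemma potential_le_path_weight:
  fixes \<phi> :: "'a \<Rightarrow> real"
  assumes "\<And>u v. {u, v} \<in> edges G \<Longrightarrow> \<phi> v - \<phi> u \<le> weight G {u, v}"
    and "q \<noteq> []" and "set (path_edges q) \<subseteq> edges G"
  shows "\<phi> (last q) - \<phi> (hd q) \<le> path_weight G q"
  using assms(2,3)
proof (induction q rule: path_edges.induct)
  case (1 u v p)
  then show ?case using assms(1)[of u v] by force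
qed simp_all

text \<open>If the telescoped bound is attained, no single step can have slack.\<close>

lemma path_steps_tight:
  fixes \<phi> :: "'a \<Rightarrow> real"
  assumes le: "\<And>u v. {u, v} \<in> edges G \<Longrightarrow> \<phi> v - \<phi> u \<le> weight G {u, v}"
    and "q \<noteq> []" and "set (path_edges q) \<subseteq> edges G"
    and "path_weight G q \<le> \<phi> (last q) - \<phi> (hd q)"
    and "(u, v) \<in> set (zip q (tl q))"
  shows "{u, v} \<in> edges G \<and> \<phi> v - \<phi> u = weight G {u, v}"
  using assms(2-)
proof (induction q rule: path_edges.induct)
  case (1 a b p)
  have "\<phi> (last (b # p)) - \<phi> b \<le> path_weight G (b # p)"
    using potential_le_path_weight[of G \<phi> "b # p", OF le] 1 by simp
  moreover have "\<phi> b - \<phi> a \<le> weight G {a, b}"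
    using le 1 by simp
  ultimately show ?case using 1 by auto
qed simp_all

text \<open>In a distinct \<open>p\<close> every node has at most one successor, so \<open>q\<close>
  must follow \<open>p\<close> from the common start; the common last node keeps it from stopping
  early.\<close>

lemma distinct_path_eqI:
  assumes "distinct p" and "distinct q" and "p \<noteq> []" and "q \<noteq> []"
    and "hd q = hd p" and "last q = last p"
    and "set (zip q (tl q)) \<subseteq> set (zip p (tl p))"
  shows "q = p"
  using assms
proof (induction p arbitrary: q)
  case Nil
  then show ?case by simp
next
  case (Cons a p)
  then obtain q' where q: "q = a # q'"
    by (cases q) auto
  show ?case
  proof (cases "q' = [] \<or> p = []")
    case True
    with Cons.prems q show ?thesis
      by (cases p; cases q') (auto split: if_splits)
  next
    case False
    then obtain b p' c q'' where p: "p = b # p'" and q': "q' = c # q''"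
      by (meson neq_Nil_conv)
    \<comment> \<open>\<open>a\<close> occurs only at the head of its list, so the pair
      \<open>(a, c)\<close> can only be the first pair of \<open>p\<close>.\<close>
    have "c = b"
      using Cons.prems p q q' by (auto dest: set_zip_leftD)
    moreover have "set (zip q' (tl q')) \<subseteq> set (zip p (tl p))"
    proof (rule subrelI)
      fix u v assume uv: "(u, v) \<in> set (zip q' (tl q'))"
      then have "u \<noteq> a"
        using Cons.prems(2) q by (auto dest: set_zip_leftD)
      with uv show "(u, v) \<in> set (zip p (tl p))"
        using Cons.prems(7) p q q' by auto
    qed
    ultimately have "q' = p"
      using Cons.IH[of q'] Cons.prems p q q' by (simp split: if_splits)
    with q show ?thesis by simp
  qed
qed

text \<open>Complementary slackness: \<open>\<phi>\<close> is a dual certificate whose tight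
  directed steps all lie on \<open>p\<close>, and a shortest path uses tight steps only.\<close>

lemma unique_shortest_path:
  fixes \<phi> :: "'a \<Rightarrow> real"
  assumes p: "is_path G p" and tight: "path_weight G p = \<phi> (last p) - \<phi> (hd p)"
    and step: "\<And>u v. {u, v} \<in> edges G \<Longrightarrow> \<phi> v - \<phi> u < weight G {u, v} \<or>
      \<phi> v - \<phi> u = weight G {u, v} \<and> (u, v) \<in> set (zip p (tl p))"
    and q: "shortest_path G q" "hd q = hd p" "last q = last p"
  shows "q = p"
proof (rule distinct_path_eqI)
  have "path_weight G q \<le> \<phi> (last q) - \<phi> (hd q)"
    using p tight q by (auto simp: shortest_path_def)
  moreover have "\<phi> v - \<phi> u \<le> weight G {u, v}" if "{u, v} \<in> edges G" for u v
    using step[OF that] by linarith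
  ultimately have "{u, v} \<in> edges G \<and> \<phi> v - \<phi> u = weight G {u, v}"
    if "(u, v) \<in> set (zip q (tl q))" for u v
    using path_steps_tight[of G \<phi> q u v] q(1) that by (auto simp: shortest_path_def is_path_def)
  with step show "set (zip q (tl q)) \<subseteq> set (zip p (tl p))"
    by fastforce
qed (use p q in \<open>auto simp: shortest_path_def is_path_def\<close>)

lemma shortest_path_exists:
  assumes "weighted_graph G" and "is_path G p"
  obtains q where "shortest_path G q" and "hd q = hd p" and "last q = last p"
proof -
  let ?S = "{q. is_path G q \<and> hd q = hd p \<and> last q = last p}"
  have "finite {q. set q \<subseteq> verts G \<and> distinct q}"
    using assms(1) by (intro finite_subset_distinct) (simp add: weighted_graph_def)
  then have "finite ?S"
    by (rule rev_finite_subset) (auto simp: is_path_def)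
  moreover have "?S \<noteq> {}"
    using assms(2) by blast
  ultimately obtain q where "q \<in> ?S" "\<And>r. r \<in> ?S \<Longrightarrow> path_weight G q \<le> path_weight G r"
    using ex_is_arg_min_if_finite[of ?S "path_weight G"]
    by (auto simp: is_arg_min_linorder)
  then show thesis
    by (intro that[of q]) (auto simp: shortest_path_def)
qed

text \<open>Some shortest path of \<open>H\<close> joins the ends of \<open>p\<close>; it is also
  shortest in \<open>G\<close>, so uniqueness identifies it with \<open>p\<close>.\<close>

lemma preserving_path_weight_le:
  assumes "shortest_paths_preserving G H"
    and p: "is_path G p"
    and unique: "\<And>q. shortest_path G q \<Longrightarrow> hd q = hd p \<Longrightarrow> last q = last p \<Longrightarrow> q = p"
    and r: "is_path G r" "hd r = hd p" "last r = last p"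
  shows "path_weight H p \<le> path_weight H r"
proof -
  have H: "weighted_graph H" "\<And>q. is_path H q \<longleftrightarrow> is_path G q"
    using assms(1) by (auto simp: shortest_paths_preserving_def is_path_def)
  with p obtain q where q: "shortest_path H q" "hd q = hd p" "last q = last p"
    by (metis shortest_path_exists)
  with assms(1) unique have "q = p"
    by (auto simp: shortest_paths_preserving_def)
  with q H r show ?thesis
    by (auto simp: shortest_path_def)
qed

section \<open>The layered graph\<close>

text \<open>Level \<open>i\<close> has centre \<open>3 * i\<close> and two leaves. One leaf is
  joined to the next centre and the other to both next leaves, so that either light edge of the next
  level closes a 5-cycle with the light path of level \<open>i\<close>.\<close>

definition layered_edges :: "nat \<Rightarrow> nat set set" where
  "layered_edges k =
     {{3 * i, 3 * i + 1} | i. i < k} \<union> {{3 * i, 3 * i + 2} | i. i < k} \<union>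
     {{3 * i + 1, 3 * i + 3} | i. Suc i < k} \<union> {{3 * i + 2, 3 * i + 4} | i. Suc i < k} \<union>
     {{3 * i + 2, 3 * i + 5} | i. Suc i < k}"

lemma vertex_div_mod [simp]:
  fixes i :: nat
  shows "Suc (3 * i) div 3 = i" "Suc (Suc (3 * i)) div 3 = i" "(3 * i + 3) div 3 = Suc i"
    "(3 * i + 4) div 3 = Suc i" "(3 * i + 5) div 3 = Suc i"
    "Suc (3 * i) mod 3 = 1" "Suc (Suc (3 * i)) mod 3 = 2" "(3 * i + 3) mod 3 = 0"
    "(3 * i + 4) mod 3 = 1" "(3 * i + 5) mod 3 = 2"
  by presburger+

definition layered_graph :: "nat \<Rightarrow> nat wgraph" where
  "layered_graph k = \<lparr>verts = {..<3 * k}, edges = layered_edges k,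
     weight = (\<lambda>e. if Min e div 3 = Max e div 3 then 3 ^ (Min e div 3) else 3 ^ k)\<rparr>"

lemma layered_graph_simps [simp]:
  "verts (layered_graph k) = {..<3 * k}"
  "edges (layered_graph k) = layered_edges k"
  "weight (layered_graph k) {u, v} = (if u div 3 = v div 3 then 3 ^ (u div 3) else 3 ^ k)"
  by (auto simp: layered_graph_def min_def max_def)

lemma layered_edges_intros:
  "i < k \<Longrightarrow> {3 * i, 3 * i + 1} \<in> layered_edges k"
  "i < k \<Longrightarrow> {3 * i, 3 * i + 2} \<in> layered_edges k"
  "Suc i < k \<Longrightarrow> {3 * i + 1, 3 * i + 3} \<in> layered_edges k"
  "Suc i < k \<Longrightarrow> {3 * i + 2, 3 * i + 4} \<in> layered_edges k"
  "Suc i < k \<Longrightarrow> {3 * i + 2, 3 * i + 5} \<in> layered_edges k"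
  "Suc i < k \<Longrightarrow> {3 * i + 3, 3 * i + 4} \<in> layered_edges k"
  "Suc i < k \<Longrightarrow> {3 * i + 3, 3 * i + 5} \<in> layered_edges k"
proof -
  show "{3 * i + 3, 3 * i + 4} \<in> layered_edges k" if "Suc i < k"
    unfolding layered_edges_def using that by (intro UnI1 CollectI exI[of _ "Suc i"]) auto
  show "{3 * i + 3, 3 * i + 5} \<in> layered_edges k" if "Suc i < k"
    unfolding layered_edges_def using that by (intro UnI1 UnI2 CollectI exI[of _ "Suc i"]) auto
qed (unfold layered_edges_def, blast+)

lemmas layered_edges_simps [simp] = layered_edges_intros[simplified]

text \<open>Light and heavy edges are separated, in both orientations, because the potential
  condition is directed.\<close>

lemma layered_edges_cases:
  assumes "{u, v} \<in> layered_edges k"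
  obtains j x y where "j < k" and "(x, y) = (3 * j, 3 * j + 1) \<or> (x, y) = (3 * j, 3 * j + 2)"
      and "(u, v) = (x, y) \<or> (u, v) = (y, x)"
    | j x y where "Suc j < k"
      and "(x, y) = (3 * j + 1, 3 * j + 3) \<or> (x, y) = (3 * j + 2, 3 * j + 4) \<or>
        (x, y) = (3 * j + 2, 3 * j + 5)"
      and "(u, v) = (x, y) \<or> (u, v) = (y, x)"
proof -
  from assms consider j where "j < k" "{u, v} = {3 * j, 3 * j + 1}"
    | j where "j < k" "{u, v} = {3 * j, 3 * j + 2}"
    | j where "Suc j < k" "{u, v} = {3 * j + 1, 3 * j + 3}"
    | j where "Suc j < k" "{u, v} = {3 * j + 2, 3 * j + 4}"
    | j where "Suc j < k" "{u, v} = {3 * j + 2, 3 * j + 5}"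
    unfolding layered_edges_def by blast
  then show thesis
    unfolding doubleton_eq_iff by cases (use that in blast)+
qed

lemma finite_layered_edges: "finite (layered_edges k)"
  by (rule finite_subset[of _ "Pow {..<3 * k}"]) (auto simp: layered_edges_def)

lemma weighted_graph_layered_graph: "weighted_graph (layered_graph k)"
proof -
  have "layered_edges k \<subseteq> {{u, v} |u v. u < 3 * k \<and> v < 3 * k \<and> u \<noteq> v}"
  proof
    fix e assume e: "e \<in> layered_edges k"
    then obtain u v where uv: "e = {u, v}"
      unfolding layered_edges_def by blast
    from e[unfolded uv] have "u < 3 * k \<and> v < 3 * k \<and> u \<noteq> v"
      by (cases rule: layered_edges_cases) auto
    with uv show "e \<in> {{u, v} |u v. u < 3 * k \<and> v < 3 * k \<and> u \<noteq> v}"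
      by blast
  qed
  then show ?thesis
    by (auto simp: weighted_graph_def layered_graph_def)
qed

text \<open>\<open>f\<close> and \<open>g\<close> give the values on levels \<open>i\<close> and \<open>i + 1\<close>, indexed by the residue modulo 3;
  \<open>a\<close> and \<open>b\<close> are the values on all levels below and above.\<close>

definition level_potential ::
    "nat \<Rightarrow> real \<Rightarrow> (nat \<Rightarrow> real) \<Rightarrow> (nat \<Rightarrow> real) \<Rightarrow> real \<Rightarrow> nat \<Rightarrow> real" where
  "level_potential i a f g b v =
     (if v div 3 < i then a else if v div 3 = i then f (v mod 3)
      else if v div 3 = Suc i then g (v mod 3) else b)"

lemma power3_bounds:
  assumes "Suc i < k"
  shows "(0::real) < 3 ^ i" and "9 * 3 ^ i \<le> (3::real) ^ k"
proof -
  have "(3::real) ^ (i + 2) \<le> 3 ^ k"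
    using assms by (intro power_increasing) auto
  then show "9 * 3 ^ i \<le> (3::real) ^ k"
    by simp
qed simp

text \<open>With \<open>L = 3 ^ i\<close> and \<open>R = 3 ^ k\<close> this path weighs
  \<open>R + 2 * L\<close>, while the rival through a leaf of level \<open>i + 1\<close> weighs
  \<open>R + 3 * L\<close>.\<close>

lemma layered_unique_shortest_from_centre:
  assumes i: "Suc i < k"
    and "shortest_path (layered_graph k) q" "hd q = 3 * i + 3" "last q = 3 * i + 2"
  shows "q = [3 * i + 3, 3 * i + 1, 3 * i, 3 * i + 2]"
proof (rule unique_shortest_path)
  define L R :: real where "L = 3 ^ i" and "R = 3 ^ k"
  note LR = L_def [symmetric] R_def [symmetric]
  note pow = power3_bounds[OF i, unfolded LR]
  \<comment> \<open>On the path \<open>\<phi>\<close> is the distance from its start. The upper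
    leaves get a value strictly between \<open>2 * L\<close> (slack on the heavy edges to
    \<open>3 * i + 2\<close>) and \<open>3 * L\<close> (slack on the light edges from the centre).
    The outer constants differ from the adjacent levels by at most \<open>3 / 2 * L\<close>, less
    than \<open>R\<close>.\<close>
  define \<phi> where "\<phi> = level_potential i (R + L)
    (\<lambda>j. R + (if j = 1 then 0 else if j = 0 then L else 2 * L))
    (\<lambda>j. if j = 0 then 0 else 5 / 2 * L) L"
  let ?p = "[3 * i + 3, 3 * i + 1, 3 * i, 3 * i + 2]"
  show "is_path (layered_graph k) ?p"
    using i by (auto simp: is_path_def insert_commute)
  show "path_weight (layered_graph k) ?p = \<phi> (last ?p) - \<phi> (hd ?p)"
    by (simp add: \<phi>_def level_potential_def L_def R_def)
  show "\<phi> v - \<phi> u < weight (layered_graph k) {u, v} \<or>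
      \<phi> v - \<phi> u = weight (layered_graph k) {u, v} \<and> (u, v) \<in> set (zip ?p (tl ?p))"
    if "{u, v} \<in> edges (layered_graph k)" for u v
    using that[simplified]
  proof (cases rule: layered_edges_cases)
    case (1 j x y)
    consider "j < i" | "j = i" | "j = Suc i" | "Suc i < j" by linarith
    then show ?thesis
      using 1(2,3) pow by cases
        (elim disjE; simp add: \<phi>_def level_potential_def LR del: mult_Suc_right)+
  next
    case (2 j x y)
    consider "Suc j < i" | "Suc j = i" | "j = i" | "j = Suc i" | "Suc i < j" by linarith
    then show ?thesis
      using 2(2,3) pow by cases
        (elim disjE; simp add: \<phi>_def level_potential_def LR del: mult_Suc_right)+
  qed
qed (use assms in auto)

lemma layered_unique_shortest_from_leaf:
  assumes i: "Suc i < k" and t: "t = 1 \<or> t = 2"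
    and "shortest_path (layered_graph k) q" "hd q = 3 * i + (3 + t)" "last q = 3 * i + 1"
  shows "q = [3 * i + (3 + t), 3 * i + 2, 3 * i, 3 * i + 1]"
proof (rule unique_shortest_path)
  define L R :: real where "L = 3 ^ i" and "R = 3 ^ k"
  note LR = L_def [symmetric] R_def [symmetric]
  note pow = power3_bounds[OF i, unfolded LR]
  \<comment> \<open>Now the upper centre gets the value between \<open>2 * L\<close> and
    \<open>3 * L\<close>. The other upper leaf is also joined to \<open>3 * i + 2\<close>; its
    positive value \<open>L\<close> makes that edge slack.\<close>
  define \<phi> where "\<phi> = level_potential i (R + L)
    (\<lambda>j. R + (if j = 2 then 0 else if j = 0 then L else 2 * L))
    (\<lambda>j. if j = t then 0 else if j = 0 then 5 / 2 * L else L) L"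
  let ?p = "[3 * i + (3 + t), 3 * i + 2, 3 * i, 3 * i + 1]"
  show "is_path (layered_graph k) ?p"
    using i t by (auto simp: is_path_def insert_commute)
  show "path_weight (layered_graph k) ?p = \<phi> (last ?p) - \<phi> (hd ?p)"
    using t by (auto simp: \<phi>_def level_potential_def L_def R_def)
  show "\<phi> v - \<phi> u < weight (layered_graph k) {u, v} \<or>
      \<phi> v - \<phi> u = weight (layered_graph k) {u, v} \<and> (u, v) \<in> set (zip ?p (tl ?p))"
    if "{u, v} \<in> edges (layered_graph k)" for u v
    using that[simplified]
  proof (cases rule: layered_edges_cases)
    case (1 j x y)
    consider "j < i" | "j = i" | "j = Suc i" | "Suc i < j" by linarith
    then show ?thesis
      using 1(2,3) t pow by cases
        (elim disjE; simp add: \<phi>_def level_potential_def LR del: mult_Suc_right)+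
  next
    case (2 j x y)
    consider "Suc j < i" | "Suc j = i" | "j = i" | "j = Suc i" | "Suc i < j" by linarith
    then show ?thesis
      using 2(2,3) t pow by cases
        (elim disjE; simp add: \<phi>_def level_potential_def LR del: mult_Suc_right)+
  qed
qed (use assms in auto)

section \<open>Growth of the light weights under preserving reweightings\<close>

lemma preserving_light_weight_doubles:
  assumes H: "shortest_paths_preserving (layered_graph k) H" and i: "Suc i < k"
    and t: "t = 1 \<or> t = 2"
  shows "weight H {3 * i, 3 * i + 1} + weight H {3 * i, 3 * i + 2}
    \<le> weight H {3 * Suc i, 3 * Suc i + t}"
proof -
  let ?x = "3 * i" and ?y = "3 * i + 3"
  \<comment> \<open>The two inequalities compare complementary arcs of one 5-cycle. Both heavy
    weights cancel in the sum, leaving twice the claim.\<close>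
  have "path_weight H [?y, ?x + 1, ?x, ?x + 2] \<le> path_weight H [?y, 3 * i + (3 + t), ?x + 2]"
    using i t
    by (intro preserving_path_weight_le[OF H] layered_unique_shortest_from_centre)
      (auto simp: is_path_def insert_commute)
  moreover have "path_weight H [3 * i + (3 + t), ?x + 2, ?x, ?x + 1] \<le>
      path_weight H [3 * i + (3 + t), ?y, ?x + 1]"
    using i t
    by (intro preserving_path_weight_le[OF H] layered_unique_shortest_from_leaf)
      (auto simp: is_path_def insert_commute)
  ultimately show ?thesis
    by (simp add: insert_commute add.assoc [symmetric] add.commute [of _ "3 :: nat"])
qed

text \<open>The bound doubles per level; the induction covers both values of \<open>t\<close>
  because both light edges enter the next bound.\<close>

lemma preserving_light_weight_ge:
  assumes H: "shortest_paths_preserving (layered_graph k) H" and "i < k" and "t = 1 \<or> t = 2"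
  shows "2 ^ i * Min (weight H ` edges H) \<le> weight H {3 * i, 3 * i + t}"
  using assms(2,3)
proof (induction i arbitrary: t)
  case 0
  have "{0, t} \<in> edges H"
    using H 0 layered_edges_intros(1,2)[of 0 k]
    by (auto simp: shortest_paths_preserving_def numeral_2_eq_2)
  moreover have "finite (edges H)"
    using H by (simp add: shortest_paths_preserving_def finite_layered_edges)
  ultimately show ?case
    by simp
next
  case (Suc i)
  have "2 ^ i * Min (weight H ` edges H) \<le> weight H {3 * i, 3 * i + 1}"
    and "2 ^ i * Min (weight H ` edges H) \<le> weight H {3 * i, 3 * i + 2}"
    using Suc.IH[of 1] Suc.IH[of 2] Suc.prems by auto
  with preserving_light_weight_doubles[OF H Suc.prems] show ?case
    by simp
qed

lemma preserving_aspect_ratio_ge: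
  assumes H: "shortest_paths_preserving (layered_graph (Suc m)) H"
  shows "2 ^ m \<le> aspect_ratio H"
proof -
  have edges: "edges H = layered_edges (Suc m)" and pos: "\<forall>e \<in> edges H. weight H e > 0"
    using H by (auto simp: shortest_paths_preserving_def weighted_graph_def)
  have fin: "finite (weight H ` edges H)"
    by (simp add: edges finite_layered_edges)
  have mem: "weight H {3 * m, 3 * m + 1} \<in> weight H ` edges H"
    unfolding edges by (intro imageI layered_edges_intros) simp
  then have "Min (weight H ` edges H) \<in> weight H ` edges H"
    using fin by (intro Min_in) auto
  then have "Min (weight H ` edges H) > 0"
    using pos by auto
  moreover have "2 ^ m * Min (weight H ` edges H) \<le> Max (weight H ` edges H)"
    using preserving_light_weight_ge[OF H, of m 1] Max_ge[OF fin mem] by simp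
  ultimately show ?thesis
    by (simp add: aspect_ratio_def pos_le_divide_eq)
qed

theorem theorem1p5:
  "\<exists>c::real. c > 0 \<and>
     (\<exists>\<^sub>\<infinity>n::nat. \<exists>G :: nat wgraph.
        weighted_graph G \<and> card (verts G) = n \<and> edges G \<noteq> {} \<and>
        (\<forall>H :: nat wgraph. shortest_paths_preserving G H \<longrightarrow>
           aspect_ratio H \<ge> 2 powr (c * real n)))"
proof (intro exI[of _ "1 / 6"] conjI)
  show "\<exists>\<^sub>\<infinity>n::nat. \<exists>G :: nat wgraph.
        weighted_graph G \<and> card (verts G) = n \<and> edges G \<noteq> {} \<and>
        (\<forall>H :: nat wgraph. shortest_paths_preserving G H \<longrightarrow>
           aspect_ratio H \<ge> 2 powr (1 / 6 * real n))"
    unfolding INFM_nat_le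
  proof (intro allI exI conjI impI)
    fix N :: nat
    \<comment> \<open>Here \<open>n / 6 = (N + 2) / 2\<close>, which is at most the exponent
      \<open>N + 1\<close> for every \<open>N\<close>, including 0.\<close>
    let ?k = "Suc (Suc N)"
    show "N \<le> 3 * ?k" by simp
    show "weighted_graph (layered_graph ?k)" by (rule weighted_graph_layered_graph)
    show "card (verts (layered_graph ?k)) = 3 * ?k" by simp
    show "edges (layered_graph ?k) \<noteq> {}"
      using layered_edges_intros(1)[of 0 ?k] by auto
    fix H assume H: "shortest_paths_preserving (layered_graph ?k) H"
    have "2 powr (1 / 6 * real (3 * ?k)) \<le> 2 powr real (Suc N)"
      by (intro powr_mono) auto
    also have "\<dots> = 2 ^ Suc N"
      by (rule powr_realpow) simp
    also have "\<dots> \<le> aspect_ratio H"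
      using H by (rule preserving_aspect_ratio_ge)
    finally show "2 powr (1 / 6 * real (3 * ?k)) \<le> aspect_ratio H" .
  qed
qed simp

end
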